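(* Let $G$ be a connected graph with $n\ge 2$ vertices. Then $$\rho(A_{\overline{\kappa}}(G))\;\le\;\frac{4\alpha'(G)}{n}.$$ Moreover, equality holds only when $G=K_n$ and $n$ is odd.
   Context: All graphs are finite, simple and undirected. For distinct vertices $u,v$ of $G$, $\kappa(u,v)$ denotes the maximum number of internally vertex-disjoint paths joining $u$ and $v$ in $G$ (an edge $uv$, if present, counts as one such path), and $\kappa(v,v)=0$ for every vertex $v$. The average connectivity matrix $A_{\overline{\kappa}}(G)$ of a graph with vertex set $\{v_1,\ldots,v_n\}$ is the $n\times n$ real symmetric matrix whose $(i,j)$-entry is $\kappa(v_i,v_j)/\binom{n}{2}$. Its spectral radius $\rho(A_{\overline{\kappa}}(G))$ is the maximum of the absolute values of its eigenvalues. The matching number $\alpha'(G)$ is the maximum size of a matching (a set of pairwise disjoint edges) in $G$. $K_n$ is the complete graph on $n$ vertices. *)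

theory Defs
  imports "Graph_Theory.Graph_Theory" "Jordan_Normal_Form.Spectral_Radius" "HOL-Library.Disjoint_Sets"
begin

text \<open>
  A finite simple undirected graph is a symmetric digraph without loops and parallel arcs
  (locale \<^locale>\<open>graph\<close>); an undirected edge is a pair of opposite arcs. As there are no
  parallel arcs, a path is determined by its list of vertices.
\<close>

definition paths_between :: "('a, 'b) pre_digraph \<Rightarrow> 'a \<Rightarrow> 'a \<Rightarrow> 'a list set" where
  "paths_between G u v = {p. vpath p G \<and> hd p = u \<and> last p = v}"

text \<open>For adjacent ends the one-edge path has no inner vertices; it is counted once because
  \<open>P\<close> below is a set.\<close>

definition internally_disjoint_paths :: "('a, 'b) pre_digraph \<Rightarrow> 'a \<Rightarrow> 'a \<Rightarrow> 'a list set \<Rightarrow> bool" where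
  "internally_disjoint_paths G u v P \<longleftrightarrow>
     P \<subseteq> paths_between G u v \<and> (\<forall>p\<in>P. \<forall>q\<in>P. p \<noteq> q \<longrightarrow> set p \<inter> set q \<subseteq> {u, v})"

definition local_connectivity :: "('a, 'b) pre_digraph \<Rightarrow> 'a \<Rightarrow> 'a \<Rightarrow> nat" where
  "local_connectivity G u v =
     (if u = v then 0 else Max {card P | P. internally_disjoint_paths G u v P})"

text \<open>The list \<open>vs\<close> is the enumeration of the vertices that indexes rows and columns.\<close>

definition average_connectivity_matrix :: "('a, 'b) pre_digraph \<Rightarrow> 'a list \<Rightarrow> real mat" where
  "average_connectivity_matrix G vs =
     mat (length vs) (length vs)
       (\<lambda>(i, j). real (local_connectivity G (vs ! i) (vs ! j)) / real (length vs choose 2))"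

definition undirected_edges :: "('a, 'b) pre_digraph \<Rightarrow> 'a set set" where
  "undirected_edges G = {{u, v} | u v. u \<rightarrow>\<^bsub>G\<^esub> v}"

definition is_matching :: "('a, 'b) pre_digraph \<Rightarrow> 'a set set \<Rightarrow> bool" where
  "is_matching G M \<longleftrightarrow> M \<subseteq> undirected_edges G \<and> disjoint M"

definition matching_number :: "('a, 'b) pre_digraph \<Rightarrow> nat" where
  "matching_number G = Max {card M | M. is_matching G M}"

end

theory Submission
  imports Defs
begin

text \<open>
  Up to the factor \<open>n choose 2\<close> the bound says that the spectral radius of the matrix of local
  connectivities is at most \<open>2 m (n - 1)\<close>, where \<open>m\<close> is the matching number. The spectral
  radius of a nonnegative matrix is at most its largest row sum, so it suffices to bound the sum of
  \<open>\<kappa>(u, v)\<close> over \<open>v\<close> for a fixed vertex \<open>u\<close>. Only the inequality \<open>\<kappa>(u, v) \<le> deg v\<close> enters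
  (\<open>card_internally_disjoint_paths_le\<close>): distinct internally disjoint paths use distinct
  last edges.

  Fix a maximum matching \<open>M\<close> and let \<open>W\<close> be the set of vertices that it misses.

  If \<open>W\<close> has at least two elements, then already the sum of all degrees is at most
  \<open>2 m (n - 1)\<close> (\<open>sum_degrees_le\<close>). Indeed \<open>W\<close> is independent, and at most \<open>|W|\<close> edges join
  the two ends of a given edge of \<open>M\<close> to \<open>W\<close>, because otherwise there would be an augmenting
  path. As \<open>u\<close> has a neighbour but \<open>\<kappa>(u, u) = 0\<close>, its row sum is strictly smaller than the
  degree sum, and the inequality of the theorem is strict.

  If \<open>W\<close> has at most one element, then \<open>n - 1 \<le> 2 m\<close>. All entries are at most \<open>n - 1\<close>, so
  the spectral radius is at most \<open>(n - 1)\<^sup>2 \<le> 2 m (n - 1)\<close>. In the case of equality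
  \<open>n = 2 m + 1\<close> is odd, and every entry off the diagonal has to attain the value \<open>n - 1\<close>
  (\<open>entries_eq_if_spectral_radius_extremal\<close>); hence all degrees are \<open>n - 1\<close> and the graph is
  complete.
\<close>

section \<open>Spectral radius of nonnegative matrices\<close>

text \<open>
  The absolute values of an eigenvector for an eigenvalue of maximal modulus form a nonnegative
  vector \<open>x\<close> with \<open>\<rho> x \<le> A x\<close>, by the triangle inequality; it is scaled to have maximum \<open>1\<close>.
\<close>

lemma spectral_radius_subeigenvector:
  fixes f :: "nat \<times> nat \<Rightarrow> real"
  assumes "k > 0" and nonneg: "\<And>i j. i < k \<Longrightarrow> j < k \<Longrightarrow> 0 \<le> f (i, j)"
  obtains x i0 where "\<And>i. i < k \<Longrightarrow> 0 \<le> x i \<and> x i \<le> 1" and "i0 < k" and "x i0 = 1"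
    and "\<And>i. i < k \<Longrightarrow>
      spectral_radius (map_mat complex_of_real (mat k k f)) * x i \<le> (\<Sum>j<k. f (i, j) * x j)"
proof -
  define A where "A = map_mat complex_of_real (mat k k f)"
  have A: "A \<in> carrier_mat k k"
    by (simp add: A_def)
  obtain z where "eigenvalue A z" and z: "spectral_radius A = cmod z"
    using spectral_radius_mem_max(1)[OF A \<open>k > 0\<close>] by (auto simp: spectrum_def)
  then obtain v where v: "v \<in> carrier_vec k" "v \<noteq> 0\<^sub>v k" "A *\<^sub>v v = z \<cdot>\<^sub>v v"
    using A by (auto simp: eigenvalue_def eigenvector_def)
  define c where "c = Max ((\<lambda>i. cmod (v $ i)) ` {..<k})"
  have "c \<in> (\<lambda>i. cmod (v $ i)) ` {..<k}"
    unfolding c_def using \<open>k > 0\<close> by (intro Max_in) auto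
  then obtain i0 where i0: "i0 < k" "c = cmod (v $ i0)"
    by auto
  have le_c: "cmod (v $ i) \<le> c" if "i < k" for i
    unfolding c_def using that by (intro Max_ge) auto
  have "c > 0"
  proof (rule ccontr)
    assume "\<not> c > 0"
    have "v = 0\<^sub>v k"
    proof (rule eq_vecI)
      fix i assume "i < dim_vec (0\<^sub>v k :: complex vec)"
      then have "cmod (v $ i) \<le> 0"
        using le_c[of i] \<open>\<not> c > 0\<close> by (auto simp del: norm_le_zero_iff)
      then show "v $ i = 0\<^sub>v k $ i"
        using \<open>i < dim_vec (0\<^sub>v k :: complex vec)\<close> by simp
    qed (use v in auto)
    with v show False by simp
  qed
  show thesis
  proof (rule that[of "\<lambda>i. cmod (v $ i) / c" i0, folded A_def])
    show "0 \<le> cmod (v $ i) / c \<and> cmod (v $ i) / c \<le> 1" if "i < k" for i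
      using le_c[OF that] \<open>c > 0\<close> by simp
    show "i0 < k" "cmod (v $ i0) / c = 1"
      using i0 \<open>c > 0\<close> by auto
    show "spectral_radius A * (cmod (v $ i) / c) \<le> (\<Sum>j<k. f (i, j) * (cmod (v $ j) / c))"
      if "i < k" for i
    proof -
      have "z * v $ i = (A *\<^sub>v v) $ i"
        using v that by simp
      also have "\<dots> = (\<Sum>j<k. of_real (f (i, j)) * v $ j)"
        using v(1) that by (auto simp: A_def scalar_prod_def lessThan_atLeast0 intro!: sum.cong)
      finally have "cmod z * cmod (v $ i) = cmod (\<Sum>j<k. of_real (f (i, j)) * v $ j)"
        by (metis norm_mult)
      also have "\<dots> \<le> (\<Sum>j<k. cmod (of_real (f (i, j)) * v $ j))"
        by (rule norm_sum)
      also have "\<dots> = (\<Sum>j<k. f (i, j) * cmod (v $ j))"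
        using nonneg that by (intro sum.cong) (auto simp: norm_mult)
      finally show ?thesis
        using \<open>c > 0\<close> by (simp add: z divide_right_mono flip: sum_divide_distrib)
    qed
  qed
qed

lemma spectral_radius_le_row_sum:
  fixes f :: "nat \<times> nat \<Rightarrow> real"
  assumes "k > 0" and nonneg: "\<And>i j. i < k \<Longrightarrow> j < k \<Longrightarrow> 0 \<le> f (i, j)"
  obtains i where "i < k"
    and "spectral_radius (map_mat complex_of_real (mat k k f)) \<le> (\<Sum>j<k. f (i, j))"
proof -
  obtain x i where x: "\<And>i. i < k \<Longrightarrow> 0 \<le> x i \<and> x i \<le> 1" and i: "i < k" "x i = 1"
    and sub: "\<And>i. i < k \<Longrightarrow>
      spectral_radius (map_mat complex_of_real (mat k k f)) * x i \<le> (\<Sum>j<k. f (i, j) * x j)"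
    using spectral_radius_subeigenvector[of k f] assms by blast
  have "(\<Sum>j<k. f (i, j) * x j) \<le> (\<Sum>j<k. f (i, j))"
    using x nonneg i by (intro sum_mono mult_left_le) auto
  with sub[of i] i that show thesis by fastforce
qed

text \<open>
  A matrix with zero diagonal and all other entries \<open>c\<close> has spectral radius \<open>(k - 1) c\<close>, and it
  is the only one below it that reaches this value. In a row where \<open>x\<close> attains its maximum \<open>1\<close>,
  the inequality \<open>\<rho> x \<le> A x\<close> leaves no slack, so every other coordinate of \<open>x\<close> equals \<open>1\<close> as
  well; then no row has slack.
\<close>

lemma entries_eq_if_spectral_radius_extremal:
  fixes f :: "nat \<times> nat \<Rightarrow> real"
  assumes "k > 0" and "c > 0"
    and nonneg: "\<And>i j. i < k \<Longrightarrow> j < k \<Longrightarrow> 0 \<le> f (i, j)"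
    and diag: "\<And>i. i < k \<Longrightarrow> f (i, i) = 0"
    and le_c: "\<And>i j. i < k \<Longrightarrow> j < k \<Longrightarrow> f (i, j) \<le> c"
    and extremal: "spectral_radius (map_mat complex_of_real (mat k k f)) = real (k - 1) * c"
    and "i < k" and "j < k" and "i \<noteq> j"
  shows "f (i, j) = c"
proof -
  obtain x i0 where x: "\<And>i. i < k \<Longrightarrow> 0 \<le> x i \<and> x i \<le> 1" and i0: "i0 < k" "x i0 = 1"
    and sub: "\<And>i. i < k \<Longrightarrow> real (k - 1) * c * x i \<le> (\<Sum>j<k. f (i, j) * x j)"
    using spectral_radius_subeigenvector[of k f, unfolded extremal] \<open>k > 0\<close> nonneg by blast
  have term_le: "f (p, q) * x q \<le> c" if "p < k" "q < k" for p q
    using mult_mono[OF le_c[OF that], of "x q" 1] x[OF that(2)] \<open>c > 0\<close> by simp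
  have tight: "f (p, q) * x q = c" if p: "p < k" "x p = 1" and q: "q < k" "p \<noteq> q" for p q
  proof -
    let ?Q = "{..<k} - {p}"
    have "(\<Sum>q<k. f (p, q) * x q) = (\<Sum>q\<in>?Q. f (p, q) * x q)"
      using p diag by (subst sum.remove[of _ p]) auto
    \<comment> \<open>Row \<open>p\<close> has \<open>k - 1\<close> terms, each at most \<open>c\<close>, whose sum is at least \<open>(k - 1) c\<close>.\<close>
    moreover have "(\<Sum>q\<in>?Q. c) = real (k - 1) * c"
      using p by simp
    ultimately have "(\<Sum>q\<in>?Q. c - f (p, q) * x q) \<le> 0"
      using sub[OF p(1)] p(2) by (simp add: sum_subtractf del: sum_constant)
    then have "(\<Sum>q\<in>?Q. c - f (p, q) * x q) = 0"
      using term_le p by (intro antisym sum_nonneg) auto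
    then have "\<forall>q\<in>?Q. c - f (p, q) * x q = 0"
      using term_le p by (subst (asm) sum_nonneg_eq_0_iff) auto
    then show ?thesis using q by auto
  qed
  have x_1: "x q = 1" if "q < k" for q
  proof (cases "q = i0")
    case False
    have "c = f (i0, q) * x q"
      using tight[OF i0 that] False by simp
    also have "\<dots> \<le> c * x q"
      using le_c[OF i0(1) that] x[OF that] by (intro mult_right_mono) auto
    finally show ?thesis
      using x[OF that] \<open>c > 0\<close> by (simp add: antisym)
  qed (use i0 in simp)
  show ?thesis
    using tight[of i j] x_1 assms by simp
qed

section \<open>Local connectivity and degrees\<close>

definition neighbours :: "('a, 'b) pre_digraph \<Rightarrow> 'a \<Rightarrow> 'a set" where
  "neighbours G v = {w. v \<rightarrow>\<^bsub>G\<^esub> w}"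

context graph
begin

lemma neighbours_subset: "neighbours G v \<subseteq> verts G - {v}"
  by (auto simp: neighbours_def arcs_ends_def arc_to_ends_def dest: no_loops)

lemma neighbours_sym: "w \<in> neighbours G v \<longleftrightarrow> v \<in> neighbours G w"
  using sym_arcs by (auto simp: neighbours_def intro: arcs_ends_symmetric)

lemma finite_neighbours [simp]: "finite (neighbours G v)"
  using neighbours_subset finite_verts by (metis finite_Diff finite_subset)

lemma card_neighbours_le: "v \<in> verts G \<Longrightarrow> card (neighbours G v) \<le> card (verts G) - 1"
  using card_mono[OF _ neighbours_subset[of v]] by simp

text \<open>
  Sending a path to its penultimate vertex is injective on \<open>P\<close>: two paths may share that vertex
  only if it is an end, hence \<open>u\<close>, and then both are the path along the edge \<open>uv\<close>.
\<close>

lemma card_internally_disjoint_paths_le: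
  assumes P: "internally_disjoint_paths G u v P" and "u \<noteq> v"
  shows "card P \<le> card (neighbours G v)"
proof -
  have path: "\<exists>q. p = q @ [v] \<and> q \<noteq> [] \<and> hd q = u \<and> distinct p \<and> last q \<rightarrow>\<^bsub>G\<^esub> v"
    if "p \<in> P" for p
  proof -
    have p: "vpath p G" "hd p = u" "last p = v"
      using P that by (auto simp: internally_disjoint_paths_def paths_between_def)
    then have "p \<noteq> []" by auto
    then have q: "p = butlast p @ [v]" 
      using p append_butlast_last_id by metis
    then have "butlast p \<noteq> []"
      using p \<open>u \<noteq> v\<close> by (metis append_Nil list.sel(1))
    moreover have "(last (butlast p), v) \<in> set (vwalk_arcs p)"
      using vwalk_arcs_append[OF \<open>butlast p \<noteq> []\<close>, of "[v]"] q by simp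
    then have "last (butlast p) \<rightarrow>\<^bsub>G\<^esub> v"
      using p(1) by (auto simp: vpath_def vwalk_def)
    moreover have "hd (butlast p) = u"
      using p(2) q \<open>butlast p \<noteq> []\<close> by (metis hd_append2)
    ultimately show ?thesis
      using p(1) q unfolding vpath_def by blast
  qed
  have "inj_on (\<lambda>p. last (butlast p)) P"
  proof (rule inj_onI, rule ccontr)
    fix p p' assume in_P: "p \<in> P" "p' \<in> P" and eq: "last (butlast p) = last (butlast p')" and "p \<noteq> p'"
    obtain q where q: "p = q @ [v]" "q \<noteq> []" "hd q = u" "distinct p"
      using path[OF in_P(1)] by blast
    obtain q' where q': "p' = q' @ [v]" "q' \<noteq> []" "hd q' = u" "distinct p'"
      using path[OF in_P(2)] by blast
    have last_eq: "last q = last q'"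
      using q(1) q'(1) eq by simp
    have last_in: "last q \<in> set q" "last q' \<in> set q'"
      using q(2) q'(2) by simp_all
    then have "last q \<in> set p \<inter> set p'"
      using q(1) q'(1) last_eq by simp
    then have "last q \<in> {u, v}"
      using P in_P \<open>p \<noteq> p'\<close> by (auto simp: internally_disjoint_paths_def)
    then have "last q = u"
      using q last_in by auto
    have single: "r = [u]" if "r \<noteq> []" "hd r = u" "last r = u" "distinct r" for r
      using that by (cases r) (auto split: if_splits)
    have "q = [u]" "q' = [u]"
      using single[of q] single[of q'] q q' last_eq \<open>last q = u\<close> by simp_all
    then show False
      using q q' \<open>p \<noteq> p'\<close> by simp
  qed
  moreover have "(\<lambda>p. last (butlast p)) ` P \<subseteq> neighbours G v"
  proof (clarify)
    fix p assume "p \<in> P"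
    then obtain q where "p = q @ [v]" "last q \<rightarrow>\<^bsub>G\<^esub> v"
      using path by blast
    then show "last (butlast p) \<in> neighbours G v"
      by (subst neighbours_sym) (simp add: neighbours_sym neighbours_def)
  qed
  ultimately show ?thesis
    by (intro card_inj_on_le) auto
qed

lemma local_connectivity_le_degree: "local_connectivity G u v \<le> card (neighbours G v)"
proof (cases "u = v")
  case False
  let ?C = "{card P | P. internally_disjoint_paths G u v P}"
  have "?C \<subseteq> {..card (neighbours G v)}"
    using card_internally_disjoint_paths_le[OF _ False] by auto
  moreover have "card {} \<in> ?C"
    by (force simp: internally_disjoint_paths_def)
  ultimately have "Max ?C \<le> card (neighbours G v)"
    by (subst Max_le_iff) (auto intro: finite_subset)
  then show ?thesis
    using False by (simp add: local_connectivity_def)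
qed (simp add: local_connectivity_def)

lemma neighbours_nonempty:
  assumes "Digraph_Component.connected G" and "u \<in> verts G" and "card (verts G) \<ge> 2"
  shows "neighbours G u \<noteq> {}"
proof -
  have "verts G \<noteq> {u}"
    using assms(3) by auto
  then obtain v where v: "v \<in> verts G" "v \<noteq> u"
    using assms(2) by blast
  have "u \<rightarrow>\<^sup>*\<^bsub>mk_symmetric G\<^esub> v"
    using assms v by (auto simp: Digraph_Component.connected_def strongly_connected_def mk_symmetric_def)
  then have "(u, v) \<in> (arcs_ends (mk_symmetric G))\<^sup>*"
    by (rule reachable_rtranclI)
  then obtain w where "u \<rightarrow>\<^bsub>mk_symmetric G\<^esub> w"
    using v by (metis converse_rtranclE)
  then have "u \<rightarrow>\<^bsub>G\<^esub> w"
    using sym_arcs arcs_ends_symmetric by (force simp: mk_symmetric_def arcs_ends_def arc_to_ends_def)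
  then show ?thesis
    by (auto simp: neighbours_def)
qed

section \<open>Degrees and maximum matchings\<close>

lemma undirected_edge_iff: "e \<in> undirected_edges G \<longleftrightarrow> (\<exists>x y. e = {x, y} \<and> y \<in> neighbours G x)"
  by (auto simp: undirected_edges_def neighbours_def)

lemma undirected_edgeE:
  assumes "e \<in> undirected_edges G"
  obtains x y where "e = {x, y}" and "x \<noteq> y" and "y \<in> neighbours G x"
    and "x \<in> verts G" and "y \<in> verts G"
  using assms neighbours_subset neighbours_sym unfolding undirected_edge_iff by blast

lemma finite_undirected_edges: "finite (undirected_edges G)"
  by (rule finite_subset[of _ "Pow (verts G)"]) (auto elim!: undirected_edgeE)

lemma finite_matching: "is_matching G M \<Longrightarrow> finite M"
  using finite_undirected_edges finite_subset by (auto simp: is_matching_def)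

lemma finite_matching_cards: "finite {card M | M. is_matching G M}"
proof -
  have "{card M | M. is_matching G M} \<subseteq> card ` Pow (undirected_edges G)"
    by (auto simp: is_matching_def)
  then show ?thesis
    using finite_undirected_edges by (meson finite_Pow_iff finite_imageI finite_subset)
qed

lemma card_matching_le: "is_matching G M \<Longrightarrow> card M \<le> matching_number G"
  unfolding matching_number_def using finite_matching_cards by (intro Max_ge) auto

lemma maximum_matching:
  obtains M where "is_matching G M" and "card M = matching_number G"
proof -
  have "is_matching G {}"
    by (simp add: is_matching_def disjoint_def)
  then have "matching_number G \<in> {card M | M. is_matching G M}"
    unfolding matching_number_def using finite_matching_cards by (intro Max_in) blast+
  then show thesis
    using that by auto
qed

lemma matching_covers:
  assumes "is_matching G M"
  shows "\<Union>M \<subseteq> verts G" and "card (\<Union>M) = 2 * card M"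
proof -
  have edge: "\<exists>x y. e = {x, y} \<and> x \<noteq> y \<and> x \<in> verts G \<and> y \<in> verts G" if "e \<in> M" for e
    using that assms unfolding is_matching_def by (meson subsetD undirected_edgeE)
  then show "\<Union>M \<subseteq> verts G"
    by blast
  have "card (\<Union>M) = sum card M"
  proof (rule card_Union_disjoint)
    show "pairwise disjnt M"
      using assms by (auto simp: is_matching_def disjoint_def pairwise_def disjnt_def)
    show "finite e" if "e \<in> M" for e
      using edge[OF that] by auto
  qed
  also have "\<dots> = (\<Sum>e\<in>M. 2)"
    by (intro sum.cong) (auto dest!: edge)
  finally show "card (\<Union>M) = 2 * card M"
    by simp
qed

lemma unmatched_not_adjacent:
  assumes M: "is_matching G M" "card M = matching_number G"
    and "a \<notin> \<Union>M" and "b \<notin> \<Union>M"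
  shows "b \<notin> neighbours G a"
proof
  assume "b \<in> neighbours G a"
  then have "is_matching G (insert {a, b} M)"
    using assms by (auto simp: is_matching_def disjoint_def undirected_edge_iff)
  moreover have "{a, b} \<notin> M"
    using assms by blast
  ultimately show False
    using card_matching_le[of "insert {a, b} M"] M finite_matching[OF M(1)] by simp
qed

text \<open>
  If \<open>a\<close> and \<open>b\<close> were different, replacing \<open>xy\<close> by \<open>xa\<close> and \<open>yb\<close> would enlarge the matching.
\<close>

lemma no_augmenting_path:
  assumes M: "is_matching G M" "card M = matching_number G"
    and xy: "{x, y} \<in> M" "x \<noteq> y"
    and a: "a \<notin> \<Union>M" "a \<in> neighbours G x"
    and b: "b \<notin> \<Union>M" "b \<in> neighbours G y"
  shows "a = b"
proof (rule ccontr)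
  assume "a \<noteq> b"
  let ?M = "M - {{x, y}}"
  have rest: "x \<notin> e" "y \<notin> e" "a \<notin> e" "b \<notin> e" if "e \<in> ?M" for e
  proof -
    have "e \<inter> {x, y} = {}"
      using that M(1) xy(1) by (intro disjointD[of M]) (auto simp: is_matching_def)
    then show "x \<notin> e" "y \<notin> e" by auto
    show "a \<notin> e" "b \<notin> e"
      using that a(1) b(1) by blast+
  qed
  have neq: "x \<noteq> b" "y \<noteq> a" "x \<noteq> a" "y \<noteq> b"
    using xy(1) a(1) b(1) by blast+
  have "is_matching G (insert {x, a} (insert {y, b} ?M))"
    unfolding is_matching_def
  proof
    have "{x, a} \<in> undirected_edges G" "{y, b} \<in> undirected_edges G"
      using a b undirected_edge_iff by blast+
    then show "insert {x, a} (insert {y, b} ?M) \<subseteq> undirected_edges G"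
      using M by (auto simp: is_matching_def)
    have "disjoint ?M"
      using M by (auto simp: is_matching_def disjoint_def)
    moreover have "{y, b} \<inter> e = {}" "{x, a} \<inter> e = {}" if "e \<in> ?M" for e
      using rest[OF that] by auto
    moreover have "{x, a} \<inter> {y, b} = {}"
      using neq xy \<open>a \<noteq> b\<close> by auto
    ultimately show "disjoint (insert {x, a} (insert {y, b} ?M))"
      unfolding disjoint_def by (metis Int_commute insertE)
  qed
  moreover have "card (insert {x, a} (insert {y, b} ?M)) = Suc (card M)"
  proof -
    have "{y, b} \<notin> ?M" "{x, a} \<notin> insert {y, b} ?M"
      using rest neq xy \<open>a \<noteq> b\<close> by blast+
    then show ?thesis
      using card_Suc_Diff1[OF finite_matching[OF M(1)] xy(1)] finite_matching[OF M(1)] by simp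
  qed
  ultimately show False
    using card_matching_le M by fastforce
qed

text \<open>
  Write \<open>U\<close> for the \<open>2 m\<close> matched vertices, \<open>W\<close> for the others and \<open>w\<close> for the size of \<open>W\<close>.
  Each matching edge sends at most \<open>w\<close> edges to \<open>W\<close>: either at most one of its ends has
  neighbours in \<open>W\<close>, or both ends have the same single neighbour there and \<open>2 \<le> w\<close>. So at most \<open>m w\<close>
  edges join \<open>U\<close> and \<open>W\<close>. Each of them contributes \<open>2\<close> to the degree sum, the edges
  inside \<open>U\<close> contribute at most \<open>2 m (2 m - 1)\<close>, and there are none inside \<open>W\<close>. The total is
  \<open>2 m (2 m - 1 + w) = 2 m (n - 1)\<close>.
\<close>

lemma sum_degrees_le:
  assumes M: "is_matching G M" "card M = matching_number G"
    and unmatched: "card (verts G - \<Union>M) \<ge> 2"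
  shows "(\<Sum>v\<in>verts G. card (neighbours G v)) \<le> 2 * card M * (card (verts G) - 1)"
proof -
  let ?U = "\<Union>M" and ?W = "verts G - \<Union>M"
  let ?w = "card (verts G - \<Union>M)" and ?m = "card M"
  note U = matching_covers[OF M(1)]
  have fin: "finite ?U" "finite ?W"
    using finite_subset[OF U(1)] by auto
  have edge: "card (neighbours G x \<inter> ?W) + card (neighbours G y \<inter> ?W) \<le> ?w"
    if xy: "{x, y} \<in> M" "x \<noteq> y" for x y
  proof (cases "neighbours G x \<inter> ?W = {} \<or> neighbours G y \<inter> ?W = {}")
    case True
    then show ?thesis
      using fin card_mono[of ?W "neighbours G x \<inter> ?W"] card_mono[of ?W "neighbours G y \<inter> ?W"] by auto
  next
    case False
    then obtain a b where "a \<in> neighbours G x \<inter> ?W" "b \<in> neighbours G y \<inter> ?W"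
      by blast
    then have "neighbours G x \<inter> ?W \<subseteq> {b}" "neighbours G y \<inter> ?W \<subseteq> {a}"
      using no_augmenting_path[OF M xy] by blast+
    then have "card (neighbours G x \<inter> ?W) \<le> 1" "card (neighbours G y \<inter> ?W) \<le> 1"
      using card_mono[of "{b}"] card_mono[of "{a}"] by auto
    then show ?thesis
      using unmatched by simp
  qed
  have "(\<Sum>x\<in>?U. card (neighbours G x \<inter> ?W)) = (\<Sum>e\<in>M. \<Sum>x\<in>e. card (neighbours G x \<inter> ?W))"
  proof (subst sum.Union_disjoint)
    show "\<forall>e\<in>M. finite e"
      using fin(1) by (meson Union_upper finite_subset)
    show "\<forall>e\<in>M. \<forall>e'\<in>M. e \<noteq> e' \<longrightarrow> e \<inter> e' = {}"
      using M(1) by (simp add: is_matching_def disjoint_def)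
  qed simp
  also have "\<dots> \<le> (\<Sum>e\<in>M. ?w)"
  proof (rule sum_mono)
    fix e assume "e \<in> M"
    then obtain x y where "e = {x, y}" "x \<noteq> y"
      using M(1) unfolding is_matching_def by (meson subsetD undirected_edgeE)
    then show "(\<Sum>x\<in>e. card (neighbours G x \<inter> ?W)) \<le> ?w"
      using edge[of x y] \<open>e \<in> M\<close> by simp
  qed
  finally have cross: "(\<Sum>x\<in>?U. card (neighbours G x \<inter> ?W)) \<le> ?m * ?w"
    by simp
  have "(\<Sum>v\<in>?W. card (neighbours G v)) = (\<Sum>v\<in>?W. card {x \<in> ?U. x \<in> neighbours G v})"
  proof (intro sum.cong arg_cong[of _ _ card])
    fix v assume "v \<in> ?W"
    then show "neighbours G v = {x \<in> ?U. x \<in> neighbours G v}"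
      using unmatched_not_adjacent[OF M] by blast
  qed simp
  also have "\<dots> = (\<Sum>x\<in>?U. card {v \<in> ?W. x \<in> neighbours G v})"
    using fin by (intro sum_multicount_gen[symmetric]) auto
  also have "\<dots> = (\<Sum>x\<in>?U. card (neighbours G x \<inter> ?W))"
    by (intro sum.cong arg_cong[of _ _ card]) (use neighbours_sym in auto)
  finally have W: "(\<Sum>v\<in>?W. card (neighbours G v)) \<le> ?m * ?w"
    using cross by simp
  have "(\<Sum>x\<in>?U. card (neighbours G x)) \<le> (\<Sum>x\<in>?U. (2 * ?m - 1) + card (neighbours G x \<inter> ?W))"
  proof (rule sum_mono)
    fix x assume x: "x \<in> ?U"
    have "neighbours G x = (neighbours G x \<inter> ?U) \<union> (neighbours G x \<inter> ?W)"
      using neighbours_subset by blast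
    then have "card (neighbours G x) \<le> card (neighbours G x \<inter> ?U) + card (neighbours G x \<inter> ?W)"
      by (metis card_Un_le)
    moreover have "card (neighbours G x \<inter> ?U) \<le> card (?U - {x})"
      using fin neighbours_subset by (intro card_mono) auto
    ultimately show "card (neighbours G x) \<le> (2 * ?m - 1) + card (neighbours G x \<inter> ?W)"
      using U(2) x by simp
  qed
  also have "\<dots> \<le> 2 * ?m * (2 * ?m - 1) + ?m * ?w"
    using cross U(2) by (simp add: sum.distrib)
  finally have "(\<Sum>v\<in>verts G. card (neighbours G v)) \<le> 2 * ?m * (2 * ?m - 1) + ?m * ?w + ?m * ?w"
    using W sum.subset_diff[OF U(1) finite_verts, of "\<lambda>v. card (neighbours G v)"] by simp
  also have "\<dots> = 2 * ?m * ((2 * ?m - 1) + ?w)"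
    by (simp add: algebra_simps)
  also have "\<dots> \<le> 2 * ?m * (card (verts G) - 1)"
  proof (cases "?m = 0")
    case False
    have "card (verts G) = 2 * ?m + ?w"
      using U fin card_mono[OF finite_verts U(1)] by (simp add: card_Diff_subset)
    then show ?thesis
      using False by simp
  qed simp
  finally show ?thesis .
qed

text \<open>
  Strictness comes from the diagonal: \<open>\<kappa>(u, u) = 0\<close>, whereas the degree of \<open>u\<close> is positive.
\<close>

lemma sum_local_connectivity_less:
  assumes M: "is_matching G M" "card M = matching_number G"
    and unmatched: "card (verts G - \<Union>M) \<ge> 2"
    and conn: "Digraph_Component.connected G" and u: "u \<in> verts G"
  shows "(\<Sum>v\<in>verts G. local_connectivity G u v) < 2 * card M * (card (verts G) - 1)"
proof -
  have "card (verts G) \<ge> 2"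
    using unmatched card_mono[of "verts G" "verts G - \<Union>M"] by simp
  then have "0 < card (neighbours G u)"
    using neighbours_nonempty[OF conn u] by (simp add: card_gt_0_iff)
  then have "(\<Sum>v\<in>verts G. local_connectivity G u v) < (\<Sum>v\<in>verts G. card (neighbours G v))"
    using local_connectivity_le_degree u
    by (intro sum_strict_mono_ex1) (auto intro!: bexI[of _ u] simp: local_connectivity_def[of G u u])
  also note sum_degrees_le[OF M unmatched]
  finally show ?thesis .
qed

lemma complete_if_degrees_maximal:
  assumes "\<And>v. v \<in> verts G \<Longrightarrow> card (neighbours G v) \<ge> card (verts G) - 1"
  shows "K\<^bsub>card (verts G)\<^esub> G"
proof -
  have "neighbours G v = verts G - {v}" if "v \<in> verts G" for v
    using assms[OF that] that neighbours_subset by (intro card_seteq) auto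
  moreover have "u \<in> verts G" if "u \<rightarrow>\<^bsub>G\<^esub> v" for u v
    using that by (auto simp: arcs_ends_def arc_to_ends_def)
  ultimately have "arcs_ends G = {(u, v). (u, v) \<in> verts G \<times> verts G \<and> u \<noteq> v}"
    unfolding neighbours_def by blast
  then show ?thesis
    using graph_axioms by (simp add: complete_digraph_def)
qed

end

section \<open>The bound\<close>

theorem theorem1p4:
  fixes G :: "('a, 'b) pre_digraph" and vs :: "'a list" and n :: nat
  assumes "graph G" and "Digraph_Component.connected G"
    and "card (verts G) = n" and "n \<ge> 2"
    and "distinct vs" and "set vs = verts G"
  shows "spectral_radius (map_mat complex_of_real (average_connectivity_matrix G vs))
           \<le> 4 * real (matching_number G) / real n
       \<and> (spectral_radius (map_mat complex_of_real (average_connectivity_matrix G vs))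
           = 4 * real (matching_number G) / real n
          \<longrightarrow> K\<^bsub>n\<^esub> G \<and> odd n)"
proof -
  interpret graph G by fact
  let ?\<rho> = "spectral_radius (map_mat complex_of_real (average_connectivity_matrix G vs))"
  let ?m = "matching_number G" and ?N = "real (n choose 2)"
  define f where "f = (\<lambda>(i, j). real (local_connectivity G (vs ! i) (vs ! j)) / ?N)"
  have len: "length vs = n"
    using assms distinct_card by metis
  then have A: "average_connectivity_matrix G vs = mat n n f"
    by (simp add: average_connectivity_matrix_def f_def)
  \<comment> \<open>\<open>choose_two\<close> is stated with truncating division.\<close>
  have "even (n * (n - 1))"
    by (cases n) auto
  then have "2 * (n choose 2) = n * (n - 1)"
    by (simp add: choose_two)
  then have "2 * ?N = real n * real (n - 1)"
    by (metis of_nat_mult of_nat_numeral)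
  then have N: "?N = real n * real (n - 1) / 2" and "?N > 0"
    using \<open>n \<ge> 2\<close> by simp_all
  have scale: "real (c * (n - 1)) / ?N = 2 * real c / real n" for c
    unfolding N using \<open>n \<ge> 2\<close> by (simp add: field_simps)
  have nonneg: "0 \<le> f (i, j)" for i j
    by (simp add: f_def)
  have bij: "bij_betw ((!) vs) {..<n} (verts G)"
    using assms len by (intro bij_betw_nth) auto
  have row: "(\<Sum>j<n. f (i, j)) = real (\<Sum>v\<in>verts G. local_connectivity G (vs ! i) v) / ?N" for i
    by (simp add: f_def sum.reindex_bij_betw[OF bij, symmetric] sum_divide_distrib)
  have vert: "vs ! i \<in> verts G" if "i < n" for i
    using bij_betwE[OF bij] that by simp
  obtain M where M: "is_matching G M" "card M = ?m"
    by (rule maximum_matching)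
  obtain i where i: "i < n" "?\<rho> \<le> (\<Sum>j<n. f (i, j))"
    using spectral_radius_le_row_sum[of n f] nonneg A \<open>n \<ge> 2\<close> by force
  show ?thesis
  proof (cases "card (verts G - \<Union>M) \<ge> 2")
    \<comment> \<open>At least two unmatched vertices: the bound is strict.\<close>
    case True
    note i(2)
    also have "(\<Sum>j<n. f (i, j)) < real (2 * ?m * (n - 1)) / ?N"
      using sum_local_connectivity_less[OF M True \<open>Digraph_Component.connected G\<close> vert[OF i(1)]]
      unfolding row using \<open>?N > 0\<close> M(2) assms(3)
      by (intro divide_strict_right_mono) (simp_all only: of_nat_less_iff)
    also have "\<dots> = 4 * real ?m / real n"
      using scale[of "2 * ?m"] by simp
    finally show ?thesis by simp
  next
    \<comment> \<open>At most one unmatched vertex: compare with the complete graph.\<close>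
    case False
    then have m: "n - 1 \<le> 2 * ?m"
      using matching_covers[OF M(1)] M(2) assms(3) diff_card_le_card_Diff[of "\<Union>M" "verts G"]
        finite_subset[OF _ finite_verts] by fastforce
    have deg: "card (neighbours G v) \<le> n - 1" if "v \<in> verts G" for v
      using card_neighbours_le[OF that] assms(3) by simp
    have f_le: "f (p, q) \<le> real (n - 1) / ?N" if "q < n" for p q
      using order_trans[OF local_connectivity_le_degree deg[OF vert[OF that]]] \<open>?N > 0\<close>
      unfolding f_def prod.case by (intro divide_right_mono) (simp_all only: of_nat_le_iff)
    have diag: "f (p, p) = 0" for p
      by (simp add: f_def local_connectivity_def)
    have "(\<Sum>j<n. f (i, j)) = (\<Sum>j\<in>{..<n} - {i}. f (i, j))"
      using i(1) diag by (subst sum.remove[of _ i]) auto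
    also have "\<dots> \<le> real (n - 1) * (real (n - 1) / ?N)"
      using sum_bounded_above[of "{..<n} - {i}" "\<lambda>j. f (i, j)" "real (n - 1) / ?N"] f_le i(1)
      by simp
    finally have le: "?\<rho> \<le> real (n - 1) * (real (n - 1) / ?N)"
      using i(2) by simp
    have value_eq: "real (n - 1) * (real (n - 1) / ?N) = 2 * real (n - 1) / real n"
      using scale[of "n - 1"] by simp
    also have "\<dots> \<le> 4 * real ?m / real n"
      using m by (intro divide_right_mono) linarith+
    finally have bound: "real (n - 1) * (real (n - 1) / ?N) \<le> 4 * real ?m / real n" .
    have "K\<^bsub>n\<^esub> G \<and> odd n" if eq: "?\<rho> = 4 * real ?m / real n"
    proof
      have extremal: "?\<rho> = real (n - 1) * (real (n - 1) / ?N)"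
        using eq le bound by simp
      then have "2 * real (n - 1) / real n = 4 * real ?m / real n"
        using eq value_eq by linarith
      then have "2 * real (n - 1) = 4 * real ?m"
        using \<open>n \<ge> 2\<close> by (subst (asm) divide_cancel_right) simp
      then have "n - 1 = 2 * ?m"
        by linarith
      then have "n = 2 * ?m + 1"
        using \<open>n \<ge> 2\<close> by linarith
      then show "odd n"
        by presburger
      have "card (neighbours G v) \<ge> n - 1" if "v \<in> verts G" for v
      proof -
        have "v \<in> (!) vs ` {..<n}"
          unfolding bij_betw_imp_surj_on[OF bij] by (rule that)
        then obtain q where q: "q < n" "v = vs ! q"
          by blast
        define p where "p = (if q = 0 then 1 else 0 :: nat)"
        have p: "p < n" "p \<noteq> q"
          using \<open>n \<ge> 2\<close> by (auto simp: p_def)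
        have "f (p, q) = real (n - 1) / ?N"
        proof (rule entries_eq_if_spectral_radius_extremal)
          show "0 < n" "0 < real (n - 1) / ?N"
            using \<open>n \<ge> 2\<close> \<open>?N > 0\<close> by simp_all
          show "spectral_radius (map_mat complex_of_real (mat n n f)) =
              real (n - 1) * (real (n - 1) / ?N)"
            using extremal by (simp only: A)
        qed (rule nonneg diag f_le p q | assumption)+
        then have "real (local_connectivity G (vs ! p) v) = real (n - 1)"
          unfolding f_def prod.case q(2)[symmetric] using \<open>?N > 0\<close>
          by (subst (asm) divide_cancel_right) simp
        then have "local_connectivity G (vs ! p) v = n - 1"
          by (simp only: of_nat_eq_iff)
        then show ?thesis
          using local_connectivity_le_degree by metis
      qed
      then show "K\<^bsub>n\<^esub> G"
        using complete_if_degrees_maximal assms(3) by simp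
    qed
    with le bound show ?thesis by linarith
  qed
qed

end
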